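(* Let $\widehat\Sigma\in\mathbb S_+^p$ have eigenvalues sorted in ascending order, $0\le\lambda_1\le\cdots\le\lambda_p$. For $\rho>0$ let $\gamma^\star(\rho)>0$ be the unique positive solution of $$\Big(\rho^2-\tfrac12\sum_{i=1}^p\lambda_i\Big)\gamma-p+\tfrac12\sum_{i=1}^p\sqrt{\lambda_i^2\gamma^2+4\lambda_i\gamma}=0,$$ and for $i\le p$ let $$x_i^\star(\rho)=\gamma^\star(\rho)\Big[1-\tfrac12\Big(\sqrt{\lambda_i^2\gamma^\star(\rho)^2+4\lambda_i\gamma^\star(\rho)}-\lambda_i\gamma^\star(\rho)\Big)\Big].$$ Then the following assertions hold: (i) $\gamma^\star(\rho)$ decreases with $\rho$, and $\lim_{\rho\to\infty}\gamma^\star(\rho)=0$; (ii) $x_i^\star(\rho)$ decreases with $\rho$, and $\lim_{\rho\to\infty}x_i^\star(\rho)=0$ for all $i\le p$; (iii) $x_1^\star(\rho)\ge\cdots\ge x_p^\star(\rho)$ for every $\rho>0$; (iv) $x_1^\star(\rho)/x_p^\star(\rho)$ decreases with $\rho$, and $\lim_{\rho\to\infty}x_1^\star(\rho)/x_p^\star(\rho)=1$.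
   Context: $\mathbb S_+^p$ is the cone of symmetric positive semidefinite real $p\times p$ matrices. The numbers $x_i^\star(\rho)$ are the eigenvalues of the estimator $X^\star=\sum_{i=1}^px_i^\star(\rho)v_iv_i^\top$, where $v_1,\dots,v_p$ are orthonormal eigenvectors of $\widehat\Sigma$ corresponding to $\lambda_1,\dots,\lambda_p$, so that $x_1^\star(\rho)/x_p^\star(\rho)$ is the condition number of $X^\star$. The positive solution $\gamma^\star(\rho)$ of the displayed equation exists and is unique for every $\rho>0$. "Decreases with $\rho$" is understood in the non-strict sense (nonincreasing as a function of $\rho\in(0,\infty)$). *)

theory Defs
  imports Complex_Main "Jordan_Normal_Form.Char_Poly"
begin

definition sym_psd :: "nat \<Rightarrow> real mat set" where
  "sym_psd p = {A \<in> carrier_mat p p.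
     transpose_mat A = A \<and> (\<forall>v \<in> carrier_vec p. 0 \<le> v \<bullet> (A *\<^sub>v v))}"

text \<open>Eigenvalues are listed with multiplicity, and indexed from 1; values of
  \<open>lam\<close> outside \<open>{1..p}\<close> are irrelevant.\<close>

definition sorted_eigenvalues :: "nat \<Rightarrow> real mat \<Rightarrow> (nat \<Rightarrow> real) \<Rightarrow> bool" where
  "sorted_eigenvalues p A lam \<longleftrightarrow>
     char_poly A = (\<Prod>i = 1..p. [:- lam i, 1:]) \<and> mono_on {1..p} lam"

definition gamma_eq :: "nat \<Rightarrow> (nat \<Rightarrow> real) \<Rightarrow> real \<Rightarrow> real \<Rightarrow> bool" where
  "gamma_eq p lam \<rho> \<gamma> \<longleftrightarrow>
     (\<rho>\<^sup>2 - 1/2 * (\<Sum>i = 1..p. lam i)) * \<gamma> - real p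
       + 1/2 * (\<Sum>i = 1..p. sqrt ((lam i)\<^sup>2 * \<gamma>\<^sup>2 + 4 * lam i * \<gamma>)) = 0"

text \<open>Meaningful for \<open>\<rho> > 0\<close>, \<open>p \<ge> 1\<close> and nonnegative \<open>lam\<close>, where
  the positive solution exists and is unique.\<close>

definition gamma_star :: "nat \<Rightarrow> (nat \<Rightarrow> real) \<Rightarrow> real \<Rightarrow> real" where
  "gamma_star p lam \<rho> = (THE \<gamma>. \<gamma> > 0 \<and> gamma_eq p lam \<rho> \<gamma>)"

definition x_star :: "nat \<Rightarrow> (nat \<Rightarrow> real) \<Rightarrow> nat \<Rightarrow> real \<Rightarrow> real" where
  "x_star p lam i \<rho> = (let \<gamma> = gamma_star p lam \<rho> in
     \<gamma> * (1 - 1/2 * (sqrt ((lam i)\<^sup>2 * \<gamma>\<^sup>2 + 4 * lam i * \<gamma>) - lam i * \<gamma>)))"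

end

theory Submission
  imports Defs
begin

text \<open>
  Everything is governed by the single function \<open>h t = (sqrt (t\<^sup>2 + 4 t) - t) / 2\<close>, named
  \<open>shrink\<close> below. For \<open>t \<ge> 0\<close> it is the nonnegative root of \<open>h\<^sup>2 = t (1 - h)\<close>. It is
  continuous, strictly increasing from \<open>h 0 = 0\<close> and stays below \<open>1\<close>. In terms of it the
  equation for \<open>\<gamma>\<close> becomes \<open>\<rho>\<^sup>2 \<gamma> + (\<Sum>i. h (\<lambda>\<^sub>i \<gamma>)) = p\<close> and \<open>x\<^sub>i = \<gamma> (1 - h (\<lambda>\<^sub>i \<gamma>))\<close>.

  The left-hand side of the equation is strictly increasing in \<open>\<gamma>\<close> and nondecreasing in
  \<open>\<rho>\<close>, so its unique solution decreases with \<open>\<rho>\<close>; since the sum is nonnegative, \<open>\<gamma> \<le> p /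
  \<rho>\<^sup>2\<close>, which tends to \<open>0\<close>. All remaining claims thereby turn into claims about the
  dependence on \<open>\<gamma>\<close>. For \<open>\<lambda> > 0\<close> the quadratic relation gives \<open>x = h (\<lambda> \<gamma>)\<^sup>2 / \<lambda>\<close>, which
  increases with \<open>\<gamma>\<close>, while \<open>x = \<gamma>\<close> for \<open>\<lambda> = 0\<close>; and \<open>x\<close> is \<open>\<gamma>\<close> times a factor tending to
  \<open>1\<close> as \<open>\<gamma>\<close> tends to \<open>0\<close>, so it vanishes with \<open>\<gamma>\<close>. The ordering in \<open>i\<close> is the
  monotonicity of \<open>h\<close>. The ratio of the extreme eigenvalues is \<open>(1 - h (\<lambda>\<^sub>1 \<gamma>)) / (1 - h
  (\<lambda>\<^sub>p \<gamma>))\<close>, which tends to \<open>1\<close> as \<open>\<gamma>\<close> tends to \<open>0\<close>; that it increases with \<open>\<gamma>\<close> is the one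
  delicate point, and is \<open>one_minus_shrink_cross\<close>.

  The sign condition \<open>0 \<le> \<lambda>\<^sub>i\<close> used throughout comes from evaluating the quadratic form of the
  matrix at an eigenvector.
\<close>

section \<open>Eigenvalues of positive semidefinite matrices\<close>

lemma sym_psd_eigenvalues_nonneg:
  assumes psd: "A \<in> sym_psd p" and eig: "sorted_eigenvalues p A lam" and i: "i \<in> {1..p}"
  shows "0 \<le> lam i"
proof -
  have A: "A \<in> carrier_mat p p" using psd by (simp add: sym_psd_def)
  have "poly (char_poly A) (lam i) = 0"
    using eig i unfolding sorted_eigenvalues_def by (auto simp: poly_prod)
  then have "eigenvalue A (lam i)" using eigenvalue_root_char_poly[OF A] by simp
  then obtain v where v: "v \<in> carrier_vec p" "v \<noteq> 0\<^sub>v p" "A *\<^sub>v v = lam i \<cdot>\<^sub>v v"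
    using A unfolding eigenvalue_def eigenvector_def by auto
  have "0 \<le> v \<bullet> (A *\<^sub>v v)" using psd v(1) by (simp add: sym_psd_def)
  also have "\<dots> = lam i * (v \<bullet> v)" using v by simp
  finally have "0 \<le> lam i * (v \<bullet> v)" .
  moreover have "0 < v \<bullet> v"
    using conjugate_square_greater_0_vec[OF v(1)] v(2) by simp
  ultimately show ?thesis by (simp add: zero_le_mult_iff)
qed

section \<open>The shrinkage function\<close>

definition shrink :: "real \<Rightarrow> real" where
  "shrink t = (sqrt (t\<^sup>2 + 4 * t) - t) / 2"

lemma shrink_zero [simp]: "shrink 0 = 0"
  by (simp add: shrink_def)

lemma continuous_on_shrink: "continuous_on UNIV shrink"
  unfolding shrink_def by (intro continuous_intros) auto

lemma shrink_nonneg: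
  assumes "0 \<le> t" shows "0 \<le> shrink t"
proof -
  have "t \<le> sqrt (t\<^sup>2 + 4 * t)" using assms by (intro real_le_rsqrt) auto
  then show ?thesis by (simp add: shrink_def)
qed

lemma shrink_less_one:
  assumes "0 \<le> t" shows "shrink t < 1"
proof -
  have "sqrt (t\<^sup>2 + 4 * t) < t + 2"
    using assms by (intro real_less_lsqrt) (auto simp: power2_eq_square algebra_simps)
  then show ?thesis by (simp add: shrink_def)
qed

lemma shrink_quadratic:
  assumes "0 \<le> t" shows "(shrink t)\<^sup>2 = t * (1 - shrink t)"
proof -
  have "(sqrt (t\<^sup>2 + 4 * t))\<^sup>2 = t\<^sup>2 + 4 * t" using assms by simp
  then show ?thesis by (simp add: shrink_def power2_eq_square field_simps)
qed

text \<open>Along the curve \<open>h\<^sup>2 = t (1 - h)\<close> a larger \<open>t\<close> cannot come with a smaller \<open>h\<close>: the left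
  side would drop while the right side grows.\<close>

lemma shrink_strict_mono:
  assumes "0 \<le> s" "s < t" shows "shrink s < shrink t"
proof (rule ccontr)
  assume "\<not> shrink s < shrink t"
  then have le: "shrink t \<le> shrink s" by simp
  have t: "0 \<le> t" using assms by simp
  have "t * (1 - shrink t) = (shrink t)\<^sup>2" using shrink_quadratic[OF t] by simp
  also have "\<dots> \<le> (shrink s)\<^sup>2" using le shrink_nonneg[OF t] by (intro power_mono)
  also have "\<dots> = s * (1 - shrink s)" using shrink_quadratic[OF assms(1)] .
  also have "\<dots> \<le> s * (1 - shrink t)" using le assms by (intro mult_left_mono) auto
  also have "\<dots> < t * (1 - shrink t)"
    using assms shrink_less_one[OF t] by (intro mult_strict_right_mono) auto
  finally show False by simp
qed

lemma shrink_mono: "0 \<le> s \<Longrightarrow> s \<le> t \<Longrightarrow> shrink s \<le> shrink t"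
  using shrink_strict_mono[of s t] by (cases "s = t") auto

lemma shrink_pos: "0 < t \<Longrightarrow> 0 < shrink t"
  using shrink_strict_mono[of 0 t] by simp

lemma scaled_one_minus_shrink_mono:
  assumes l: "0 \<le> l" and g: "0 \<le> g1" "g1 \<le> g2"
  shows "g1 * (1 - shrink (l * g1)) \<le> g2 * (1 - shrink (l * g2))"
proof (cases "l = 0")
  case False
  then have pos: "0 < l" using l by simp
  have le: "l * g1 \<le> l * g2" using g l by (intro mult_left_mono)
  have "(shrink (l * g1))\<^sup>2 \<le> (shrink (l * g2))\<^sup>2"
    using shrink_mono[OF _ le] shrink_nonneg[of "l * g1"] l g by (intro power_mono) auto
  then have "l * (g1 * (1 - shrink (l * g1))) \<le> l * (g2 * (1 - shrink (l * g2)))"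
    using shrink_quadratic[of "l * g1"] shrink_quadratic[of "l * g2"] l g
    by (simp add: mult.assoc)
  then show ?thesis using pos by simp
qed (use g in simp)

text \<open>This is the monotonicity in \<open>\<gamma>\<close> of \<open>(1 - shrink (a \<gamma>)) / (1 - shrink (b \<gamma>))\<close>, with
  the denominators cleared. For \<open>a = 0\<close> the numerator is constant. Otherwise put \<open>u =
  shrink (a g1)\<close> and \<open>v = shrink (b g1)\<close>. Multiplying \<open>\<gamma>\<close> by \<open>c = g2 / g1\<close> takes \<open>u\<close> to \<open>k
  u\<close> and \<open>v\<close> to \<open>m v\<close>, where the quadratic relation forces \<open>k\<^sup>2 (1 - u) / (1 - k u) = c =
  m\<^sup>2 (1 - v) / (1 - m v)\<close>. The function \<open>k\<^sup>2 (1 - u) / (1 - k u)\<close> strictly increases with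
  \<open>k\<close> and, for \<open>k \<ge> 1\<close>, does not decrease with \<open>u\<close>. As \<open>u \<le> v\<close>, this gives \<open>m \<le> k\<close>: the
  larger eigenvalue responds relatively less. Then \<open>(1 - u) / (1 - k u) = c / k\<^sup>2\<close> is at
  most \<open>(1 - v) / (1 - m v) = c / m\<^sup>2\<close>.\<close>

lemma one_minus_shrink_cross:
  assumes l: "0 \<le> a" "a \<le> b" and g: "0 < g1" "g1 \<le> g2"
  shows "(1 - shrink (a * g1)) * (1 - shrink (b * g2))
           \<le> (1 - shrink (a * g2)) * (1 - shrink (b * g1))"
proof (cases "a = 0")
  case True
  then show ?thesis using shrink_mono[of "b * g1" "b * g2"] l g
    by (simp add: mult_left_mono)
next
  case False
  then have a: "0 < a" and b: "0 < b" using l by auto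
  define u v where "u = shrink (a * g1)" and "v = shrink (b * g1)"
  define u' v' where "u' = shrink (a * g2)" and "v' = shrink (b * g2)"
  define k m where "k = u' / u" and "m = v' / v"
  have g2: "0 < g2" using g by simp
  have pos: "0 < u" "0 < v" "0 < u'" "0 < v'"
    unfolding u_def v_def u'_def v'_def using a b g g2 by (auto intro!: shrink_pos)
  have lt1: "u < 1" "v < 1" "u' < 1" "v' < 1"
    unfolding u_def v_def u'_def v'_def using a b g g2 by (auto intro!: shrink_less_one)
  have uv: "u \<le> v" unfolding u_def v_def using l g by (intro shrink_mono mult_right_mono) auto
  have uu': "u \<le> u'" unfolding u_def u'_def using l g by (intro shrink_mono mult_left_mono) auto
  have u': "u' = k * u" and v': "v' = m * v" using pos by (auto simp: k_def m_def)
  have k1: "1 \<le> k" using uu' pos by (simp add: k_def)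
  have m0: "0 < m" using pos by (simp add: m_def)
  have qu: "u\<^sup>2 = a * g1 * (1 - u)" and qv: "v\<^sup>2 = b * g1 * (1 - v)"
    and qu': "u'\<^sup>2 = a * g2 * (1 - u')" and qv': "v'\<^sup>2 = b * g2 * (1 - v')"
    unfolding u_def v_def u'_def v'_def using a b g g2 by (auto intro!: shrink_quadratic)
  have "a * (g1 * (k\<^sup>2 * (1 - u))) = k\<^sup>2 * u\<^sup>2" using qu by simp
  also have "\<dots> = a * (g2 * (1 - k * u))" using qu' by (simp add: u' power_mult_distrib)
  finally have cu: "g1 * (k\<^sup>2 * (1 - u)) = g2 * (1 - k * u)" using a by simp
  have "b * (g1 * (m\<^sup>2 * (1 - v))) = m\<^sup>2 * v\<^sup>2" using qv by simp
  also have "\<dots> = b * (g2 * (1 - m * v))" using qv' by (simp add: v' power_mult_distrib)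
  finally have cv: "g1 * (m\<^sup>2 * (1 - v)) = g2 * (1 - m * v)" using b by simp
  have mk: "m \<le> k"
  proof (rule ccontr)
    assume "\<not> m \<le> k"
    then have km: "k < m" by simp
    have 1: "0 < 1 - k * u" and 2: "0 < 1 - m * v" using lt1 u' v' by auto
    have "(1 - u) * (1 - m * v) \<le> (1 - v) * (1 - k * u)"
    proof -
      \<comment> \<open>\<open>(1 - u) / (1 - k u) = 1 + (k - 1) u / (1 - k u)\<close>, so only the excess over \<open>1\<close>
        has to be compared.\<close>
      have "(k - 1) * u * (1 - v) \<le> (m - 1) * v * (1 - u)"
        using k1 km uv pos lt1 by (intro mult_mono) auto
      moreover have "(1 - v) * (1 - k * u) - (1 - u) * (1 - m * v)
          = (m - 1) * v * (1 - u) - (k - 1) * u * (1 - v)"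
        by (simp add: algebra_simps)
      ultimately show ?thesis by linarith
    qed
    then have "k\<^sup>2 * ((1 - u) * (1 - m * v)) \<le> k\<^sup>2 * ((1 - v) * (1 - k * u))"
      by (intro mult_left_mono) auto
    also have "\<dots> < m\<^sup>2 * ((1 - v) * (1 - k * u))"
      using km k1 1 lt1 by (intro mult_strict_right_mono power_strict_mono) auto
    finally have "g1 * (k\<^sup>2 * (1 - u)) * (1 - m * v) < g1 * (m\<^sup>2 * (1 - v)) * (1 - k * u)"
      using g by (simp add: mult.assoc)
    then show False unfolding cu cv by (simp add: mult.commute mult.left_commute)
  qed
  have "g1 * m\<^sup>2 * ((1 - u) * (1 - v)) \<le> g1 * k\<^sup>2 * ((1 - u) * (1 - v))"
    using mk m0 g lt1 by (intro mult_right_mono mult_left_mono power_mono) auto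
  then have "(1 - u) * (g1 * (m\<^sup>2 * (1 - v))) \<le> (g1 * (k\<^sup>2 * (1 - u))) * (1 - v)"
    by (simp add: ac_simps)
  then have "g2 * ((1 - u) * (1 - m * v)) \<le> g2 * ((1 - k * u) * (1 - v))"
    unfolding cu cv by (simp add: ac_simps)
  then have "(1 - u) * (1 - v') \<le> (1 - u') * (1 - v)" using g2 by (simp add: u' v')
  then show ?thesis by (simp add: u_def v_def u'_def v'_def)
qed

section \<open>The solution of the equation\<close>

lemma gamma_eq_iff_shrink:
  "gamma_eq p lam \<rho> \<gamma> \<longleftrightarrow> \<rho>\<^sup>2 * \<gamma> + (\<Sum>i = 1..p. shrink (lam i * \<gamma>)) = real p"
proof -
  have "(\<Sum>i = 1..p. shrink (lam i * \<gamma>))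
      = (\<Sum>i = 1..p. 1/2 * sqrt ((lam i)\<^sup>2 * \<gamma>\<^sup>2 + 4 * lam i * \<gamma>) - 1/2 * \<gamma> * lam i)"
    by (intro sum.cong) (auto simp: shrink_def power_mult_distrib field_simps)
  also have "\<dots> = 1/2 * (\<Sum>i = 1..p. sqrt ((lam i)\<^sup>2 * \<gamma>\<^sup>2 + 4 * lam i * \<gamma>))
      - 1/2 * \<gamma> * (\<Sum>i = 1..p. lam i)"
    by (simp only: sum_subtractf sum_distrib_left)
  finally show ?thesis unfolding gamma_eq_def by (auto simp: algebra_simps)
qed

lemma x_star_eq_shrink:
  "x_star p lam i \<rho> = gamma_star p lam \<rho> * (1 - shrink (lam i * gamma_star p lam \<rho>))"
  by (simp add: x_star_def Let_def shrink_def power_mult_distrib mult.assoc)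

lemma gamma_equation_strict_mono:
  assumes nn: "\<forall>i\<in>{1..p}. 0 \<le> lam i" and "0 < \<rho>" "0 \<le> g1" "g1 < g2"
  shows "\<rho>\<^sup>2 * g1 + (\<Sum>i = 1..p. shrink (lam i * g1))
       < \<rho>\<^sup>2 * g2 + (\<Sum>i = 1..p. shrink (lam i * g2))"
proof (rule add_less_le_mono)
  show "(\<Sum>i = 1..p. shrink (lam i * g1)) \<le> (\<Sum>i = 1..p. shrink (lam i * g2))"
    using assms by (intro sum_mono shrink_mono mult_left_mono) auto
qed (use assms in simp)

lemma gamma_eq_ex1:
  assumes p: "1 \<le> p" and nn: "\<forall>i\<in>{1..p}. 0 \<le> lam i" and \<rho>: "0 < \<rho>"
  shows "\<exists>!\<gamma>. 0 < \<gamma> \<and> gamma_eq p lam \<rho> \<gamma>"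
proof (rule ex_ex1I)
  define F where "F \<gamma> = \<rho>\<^sup>2 * \<gamma> + (\<Sum>i = 1..p. shrink (lam i * \<gamma>))" for \<gamma>
  have cont: "continuous_on {0..p / \<rho>\<^sup>2} F" unfolding F_def
    by (intro continuous_intros continuous_on_compose2[OF continuous_on_shrink]) auto
  have F0: "F 0 = 0" by (simp add: F_def)
  have "0 \<le> (\<Sum>i = 1..p. shrink (lam i * (p / \<rho>\<^sup>2)))"
    using nn by (intro sum_nonneg shrink_nonneg mult_nonneg_nonneg) auto
  then have Fend: "real p \<le> F (p / \<rho>\<^sup>2)" using \<rho> by (simp add: F_def)
  obtain \<gamma> where \<gamma>: "0 \<le> \<gamma>" "F \<gamma> = real p"
    using IVT'[OF _ Fend _ cont] F0 by auto
  then have "0 < \<gamma>" using F0 p by (cases "\<gamma> = 0") auto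
  with \<gamma> show "\<exists>\<gamma>. 0 < \<gamma> \<and> gamma_eq p lam \<rho> \<gamma>" by (auto simp: gamma_eq_iff_shrink F_def)
next
  fix g1 g2 assume "0 < g1 \<and> gamma_eq p lam \<rho> g1" "0 < g2 \<and> gamma_eq p lam \<rho> g2"
  then show "g1 = g2"
    using gamma_equation_strict_mono[OF nn \<rho>, of g1 g2]
      gamma_equation_strict_mono[OF nn \<rho>, of g2 g1]
    by (cases g1 g2 rule: linorder_cases) (auto simp: gamma_eq_iff_shrink)
qed

lemma gamma_star_solves:
  assumes "1 \<le> p" "\<forall>i\<in>{1..p}. 0 \<le> lam i" "0 < \<rho>"
  shows "0 < gamma_star p lam \<rho>"
    and "\<rho>\<^sup>2 * gamma_star p lam \<rho> + (\<Sum>i = 1..p. shrink (lam i * gamma_star p lam \<rho>)) = real p"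
  using theI'[OF gamma_eq_ex1[OF assms]] 
  by (simp_all add: gamma_star_def gamma_eq_iff_shrink)

lemma gamma_star_antimono:
  assumes p: "1 \<le> p" and nn: "\<forall>i\<in>{1..p}. 0 \<le> lam i" and r: "0 < r" "r \<le> s"
  shows "gamma_star p lam s \<le> gamma_star p lam r"
proof (rule ccontr)
  let ?g = "gamma_star p lam"
  assume "\<not> ?g s \<le> ?g r"
  then have less: "?g r < ?g s" by simp
  have s: "0 < s" using r by simp
  note gr = gamma_star_solves[OF p nn r(1)] and gs = gamma_star_solves[OF p nn s]
  have "r\<^sup>2 * ?g r \<le> s\<^sup>2 * ?g r"
    using gr(1) r by (intro mult_right_mono power_mono) auto
  then have "real p \<le> s\<^sup>2 * ?g r + (\<Sum>i = 1..p. shrink (lam i * ?g r))" using gr(2) by simp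
  also have "\<dots> < real p"
    using gamma_equation_strict_mono[OF nn s _ less] gr(1) gs(2) by simp
  finally show False by simp
qed

lemma gamma_star_le:
  assumes p: "1 \<le> p" and nn: "\<forall>i\<in>{1..p}. 0 \<le> lam i" and \<rho>: "0 < \<rho>"
  shows "gamma_star p lam \<rho> \<le> real p / \<rho>\<^sup>2"
proof -
  let ?g = "gamma_star p lam \<rho>"
  note g = gamma_star_solves[OF p nn \<rho>]
  have "0 \<le> (\<Sum>i = 1..p. shrink (lam i * ?g))"
    using nn g(1) by (intro sum_nonneg shrink_nonneg mult_nonneg_nonneg) auto
  then have "\<rho>\<^sup>2 * ?g \<le> real p" using g(2) by linarith
  then show ?thesis using \<rho> by (simp add: field_simps)
qed

lemma gamma_star_tendsto_zero:
  assumes p: "1 \<le> p" and nn: "\<forall>i\<in>{1..p}. 0 \<le> lam i"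
  shows "(gamma_star p lam \<longlongrightarrow> 0) at_top"
proof (rule tendsto_sandwich)
  show "\<forall>\<^sub>F \<rho> in at_top. 0 \<le> gamma_star p lam \<rho>"
    using eventually_gt_at_top[of "0 :: real"]
    by eventually_elim (use gamma_star_solves(1)[OF p nn] in \<open>auto intro: less_imp_le\<close>)
  show "\<forall>\<^sub>F \<rho> in at_top. gamma_star p lam \<rho> \<le> real p / \<rho>\<^sup>2"
    using eventually_gt_at_top[of "0 :: real"]
    by eventually_elim (use gamma_star_le[OF p nn] in auto)
  show "((\<lambda>\<rho>::real. real p / \<rho>\<^sup>2) \<longlongrightarrow> 0) at_top"
    by (intro tendsto_divide_0[OF tendsto_const] filterlim_at_top_imp_at_infinity
        filterlim_pow_at_top filterlim_ident) auto
qed auto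

section \<open>Behaviour of the estimator's eigenvalues\<close>

theorem proposition3p5:
  fixes p :: nat and \<Sigma> :: "real mat" and lam :: "nat \<Rightarrow> real"
  assumes "p \<ge> 1"
    and "\<Sigma> \<in> sym_psd p"
    and "sorted_eigenvalues p \<Sigma> lam"
  shows
    "(antimono_on {0<..} (gamma_star p lam) \<and> (gamma_star p lam \<longlongrightarrow> 0) at_top) \<and>
     (\<forall>i \<in> {1..p}. antimono_on {0<..} (x_star p lam i) \<and> (x_star p lam i \<longlongrightarrow> 0) at_top) \<and>
     (\<forall>\<rho>>0. antimono_on {1..p} (\<lambda>i. x_star p lam i \<rho>)) \<and>
     (antimono_on {0<..} (\<lambda>\<rho>. x_star p lam 1 \<rho> / x_star p lam p \<rho>) \<and>
      ((\<lambda>\<rho>. x_star p lam 1 \<rho> / x_star p lam p \<rho>) \<longlongrightarrow> 1) at_top)"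
proof -
  define g where "g = gamma_star p lam"
  have nn: "\<forall>i\<in>{1..p}. 0 \<le> lam i"
    using sym_psd_eigenvalues_nonneg assms(2,3) by blast
  have mono: "mono_on {1..p} lam" using assms(3) by (simp add: sorted_eigenvalues_def)
  have gpos: "0 < g \<rho>" if "0 < \<rho>" for \<rho>
    using gamma_star_solves(1)[OF assms(1) nn that] by (simp add: g_def)
  have ganti: "g s \<le> g r" if "0 < r" "r \<le> s" for r s
    using gamma_star_antimono[OF assms(1) nn that] by (simp add: g_def)
  have glim: "(g \<longlongrightarrow> 0) at_top"
    using gamma_star_tendsto_zero[OF assms(1) nn] by (simp add: g_def)
  have x: "x_star p lam i \<rho> = g \<rho> * (1 - shrink (lam i * g \<rho>))" for i \<rho>
    by (simp add: x_star_eq_shrink g_def)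
  have slim: "((\<lambda>\<rho>. 1 - shrink (lam i * g \<rho>)) \<longlongrightarrow> 1) at_top" for i
  proof -
    have "((\<lambda>\<rho>. lam i * g \<rho>) \<longlongrightarrow> 0) at_top" using tendsto_mult_right_zero[OF glim] by simp
    moreover have "isCont shrink 0"
      using continuous_on_shrink by (simp add: continuous_on_eq_continuous_at)
    ultimately have "((\<lambda>\<rho>. shrink (lam i * g \<rho>)) \<longlongrightarrow> shrink 0) at_top"
      by (rule isCont_tendsto_compose[rotated])
    from tendsto_diff[OF tendsto_const this] show ?thesis by simp
  qed
  have xanti: "antimono_on {0<..} (x_star p lam i)" if "i \<in> {1..p}" for i
    using scaled_one_minus_shrink_mono[OF nn[rule_format, OF that]] gpos ganti
    by (intro monotone_onI) (auto simp: x less_imp_le)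
  have xlim: "(x_star p lam i \<longlongrightarrow> 0) at_top" for i
    using tendsto_mult[OF glim slim[of i]] by (simp add: x[abs_def])
  have xsorted: "antimono_on {1..p} (\<lambda>i. x_star p lam i \<rho>)" if "0 < \<rho>" for \<rho>
  proof (rule monotone_onI)
    fix i j assume ij: "i \<in> {1..p}" "j \<in> {1..p}" "i \<le> j"
    then have "lam i \<le> lam j" using mono by (simp add: mono_on_def)
    then have "shrink (lam i * g \<rho>) \<le> shrink (lam j * g \<rho>)"
      using nn[rule_format, OF ij(1)] gpos[OF that] by (intro shrink_mono mult_right_mono) auto
    then show "x_star p lam j \<rho> \<le> x_star p lam i \<rho>"
      using gpos[OF that] by (simp add: x)
  qed
  have ends: "1 \<in> {1..p}" "p \<in> {1..p}" using assms(1) by auto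
  have l1p: "lam 1 \<le> lam p" using mono ends assms(1) by (simp add: mono_on_def)
  have ratio: "x_star p lam 1 \<rho> / x_star p lam p \<rho>
      = (1 - shrink (lam 1 * g \<rho>)) / (1 - shrink (lam p * g \<rho>))" if "0 < \<rho>" for \<rho>
    using gpos[OF that] by (simp add: x)
  have ratio_anti: "antimono_on {0<..} (\<lambda>\<rho>. x_star p lam 1 \<rho> / x_star p lam p \<rho>)"
  proof (rule monotone_onI)
    fix r s :: real assume rs: "r \<in> {0<..}" "s \<in> {0<..}" "r \<le> s"
    then have r: "0 < r" and s: "0 < s" by auto
    have "0 < 1 - shrink (lam p * g \<rho>)" if "0 < \<rho>" for \<rho>
      using shrink_less_one[of "lam p * g \<rho>"] nn[rule_format, OF ends(2)] gpos[OF that] by simp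
    from this[OF r] this[OF s]
    show "x_star p lam 1 s / x_star p lam p s \<le> x_star p lam 1 r / x_star p lam p r"
      unfolding ratio[OF r] ratio[OF s]
      using one_minus_shrink_cross[OF nn[rule_format, OF ends(1)] l1p gpos[OF s] ganti[OF r rs(3)]]
      by (simp add: divide_le_eq le_divide_eq)
  qed
  have "((\<lambda>\<rho>. (1 - shrink (lam 1 * g \<rho>)) / (1 - shrink (lam p * g \<rho>))) \<longlongrightarrow> 1) at_top"
    using tendsto_divide[OF slim[of 1] slim[of p]] by simp
  moreover have "\<forall>\<^sub>F \<rho> in at_top. (1 - shrink (lam 1 * g \<rho>)) / (1 - shrink (lam p * g \<rho>))
      = x_star p lam 1 \<rho> / x_star p lam p \<rho>"
    using eventually_gt_at_top[of "0 :: real"] by eventually_elim (rule ratio[symmetric])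
  ultimately have ratio_lim: "((\<lambda>\<rho>. x_star p lam 1 \<rho> / x_star p lam p \<rho>) \<longlongrightarrow> 1) at_top"
    by (rule Lim_transform_eventually)
  have "antimono_on {0<..} (gamma_star p lam)"
    using ganti by (intro monotone_onI) (auto simp: g_def)
  then show ?thesis
    using glim xanti xlim xsorted ratio_anti ratio_lim by (auto simp: g_def)
qed

end
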